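(* Let $\mu_1,\dots,\mu_p$ be real numbers and let $q$ be a positive integer with $q<p$ and $\gcd(p,q)=1$. For $\ell=1,\dots,p$ define $$\mathcal S_\ell=\{\ell,\ell+1,\dots,\ell+q-1\},$$ where an index $i>p$ is interpreted as $i-p$. Then $\mu_j=0$ for all $j=1,\dots,p$ if and only if $\sum_{j\in\mathcal S_\ell}\mu_j=0$ for all $\ell=1,\dots,p$.
   Context: The indices are taken cyclically in $\{1,\dots,p\}$, so each $\mathcal S_\ell$ is a cyclic block of $q$ consecutive indices. *)

theory Defs
  imports Complex_Main
begin

definition wrap_index :: "nat \<Rightarrow> nat \<Rightarrow> nat" where
  "wrap_index p i = (if i > p then i - p else i)"

definition cyclic_block :: "nat \<Rightarrow> nat \<Rightarrow> nat \<Rightarrow> nat set" where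
  "cyclic_block p q l = wrap_index p ` {l..l + q - 1}"

end

theory Submission
  imports Defs
begin

text \<open>
  Extend \<open>\<mu>\<close> to a \<open>p\<close>-periodic sequence. Subtracting the sums over two neighbouring
  blocks shows that the sequence also has period \<open>q\<close>; as \<open>p\<close> and \<open>q\<close> are coprime it is
  constant, and a vanishing block sum says that \<open>q\<close> times this constant is zero.
\<close>

lemma periodic_add_mult:
  fixes f :: "nat \<Rightarrow> 'a"
  assumes "\<And>n. f (n + p) = f n"
  shows "f (n + p * k) = f n"
proof (induction k)
  case (Suc k)
  have "f (n + p * Suc k) = f ((n + p * k) + p)"
    by (simp add: algebra_simps)
  with Suc show ?case
    by (simp add: assms)
qed simp

text \<open>By Bezout some multiple of \<open>q\<close> exceeds a multiple of \<open>p\<close> by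
  exactly one, so moving from \<open>n\<close> to \<open>Suc n\<close> amounts to moving by whole
  periods.\<close>

lemma coprime_periods_imp_constant:
  fixes f :: "nat \<Rightarrow> 'a"
  assumes p: "\<And>n. f (n + p) = f n" and q: "\<And>n. f (n + q) = f n"
    and "q \<noteq> 0" and "coprime p q"
  shows "f n = f 0"
proof (induction n)
  case (Suc n)
  obtain x y where xy: "q * x = p * y + 1"
    using bezout_nat[of q p] assms(3,4) by (auto simp: gcd.commute)
  have "f (Suc n) = f (Suc n + p * y)"
    by (rule periodic_add_mult[of f p, OF p, symmetric])
  also have "\<dots> = f (n + q * x)"
    by (simp add: xy)
  also have "\<dots> = f n"
    by (rule periodic_add_mult[of f q, OF q])
  finally show ?case
    using Suc by simp
qed simp

lemma wrap_index_Suc: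
  assumes "n < 2 * p"
  shows "wrap_index p (Suc n) = Suc (n mod p)"
proof (cases "n < p")
  case False
  then have "n mod p = n - p"
    using assms by (simp add: mod_if)
  with False show ?thesis
    by (simp add: wrap_index_def)
qed (simp add: wrap_index_def)

text \<open>Distinct indices with the same image differ by exactly \<open>p\<close>, too far apart
  for \<open>q\<close> \<le> \<open>p\<close> consecutive indices.\<close>

lemma inj_on_wrap_index:
  assumes "0 < l" and "q \<le> p"
  shows "inj_on (wrap_index p) {l..l + q - 1}"
  using assms by (auto simp: inj_on_def wrap_index_def split: if_splits)

text \<open>Replaces the sum over an image set by one over offsets from the start of the block, so
  that neighbouring blocks can be compared by shifting.\<close>

lemma sum_cyclic_block:
  fixes \<mu> :: "nat \<Rightarrow> 'a::comm_monoid_add"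
  assumes "0 < q" and "q \<le> p" and "i < p"
  shows "(\<Sum>j\<in>cyclic_block p q (Suc i). \<mu> j) = (\<Sum>k<q. \<mu> (Suc ((i + k) mod p)))"
proof -
  have "(\<Sum>j\<in>cyclic_block p q (Suc i). \<mu> j) = (\<Sum>j\<in>{Suc i..Suc i + q - 1}. \<mu> (wrap_index p j))"
    unfolding cyclic_block_def using assms
    by (subst sum.reindex[OF inj_on_wrap_index]) auto
  also have "\<dots> = (\<Sum>k<q. \<mu> (wrap_index p (Suc (i + k))))"
    by (rule sum.reindex_bij_witness[of _ "\<lambda>k. Suc (i + k)" "\<lambda>j. j - Suc i"]) (use assms in auto)
  also have "\<dots> = (\<Sum>k<q. \<mu> (Suc ((i + k) mod p)))"
    \<comment> \<open>Here \<open>i + k < 2 * p\<close>, so wrapping once is enough.\<close>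
    using assms by (intro sum.cong) (auto simp: wrap_index_Suc)
  finally show ?thesis .
qed

theorem lemma1:
  fixes p q :: nat and \<mu> :: "nat \<Rightarrow> real"
  assumes "0 < q" and "q < p" and "gcd p q = 1"
  shows "(\<forall>j\<in>{1..p}. \<mu> j = 0) \<longleftrightarrow>
         (\<forall>l\<in>{1..p}. (\<Sum>j\<in>cyclic_block p q l. \<mu> j) = 0)"
proof -
  \<comment> \<open>The periodic extension, indexed from 0: \<open>\<nu> n\<close> stands for the
    entry of \<mu> at \<open>n + 1\<close>.\<close>
  define \<nu> where "\<nu> n = \<mu> (Suc (n mod p))" for n
  have block: "(\<Sum>j\<in>cyclic_block p q (Suc i). \<mu> j) = (\<Sum>k<q. \<nu> (i + k))" if "i < p" for i
    using sum_cyclic_block[of q p i \<mu>] assms that by (simp add: \<nu>_def)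
  show ?thesis
  proof
    assume zero: "\<forall>j\<in>{1..p}. \<mu> j = 0"
    have \<nu>_zero: "\<nu> n = 0" for n
      using zero assms by (simp add: \<nu>_def Suc_le_eq)
    show "\<forall>l\<in>{1..p}. (\<Sum>j\<in>cyclic_block p q l. \<mu> j) = 0"
    proof
      fix l assume l: "l \<in> {1..p}"
      then obtain i where i: "l = Suc i"
        by (cases l) simp_all
      with l have "i < p"
        by simp
      then show "(\<Sum>j\<in>cyclic_block p q l. \<mu> j) = 0"
        unfolding i by (simp only: block \<nu>_zero sum.neutral_const)
    qed
  next
    assume blocks: "\<forall>l\<in>{1..p}. (\<Sum>j\<in>cyclic_block p q l. \<mu> j) = 0"
    \<comment> \<open>The hypothesis covers only \<open>p\<close> starting points; reducing
      \<open>n\<close> modulo \<open>p\<close> extends it to every window of length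
      \<open>q\<close>.\<close>
    have sum_zero: "(\<Sum>k<q. \<nu> (n + k)) = 0" for n
    proof -
      have "(\<Sum>k<q. \<nu> (n + k)) = (\<Sum>k<q. \<nu> (n mod p + k))"
        by (simp add: \<nu>_def mod_add_left_eq)
      also have "\<dots> = 0"
        using block[of "n mod p"] blocks assms by (simp add: Suc_le_eq)
      finally show ?thesis .
    qed
    have period_q: "\<nu> (n + q) = \<nu> n" for n
    proof -
      \<comment> \<open>A window of length \<open>q + 1\<close> is split at its first and at its
        last term; both remaining sums vanish by \<open>sum_zero\<close>.\<close>
      have "\<nu> n + (\<Sum>k<q. \<nu> (Suc n + k)) = (\<Sum>k<Suc q. \<nu> (n + k))"
        by (subst sum.lessThan_Suc_shift) simp
      also have "\<dots> = (\<Sum>k<q. \<nu> (n + k)) + \<nu> (n + q)"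
        by simp
      finally show ?thesis
        by (simp only: sum_zero)
    qed
    have period_p: "\<nu> (n + p) = \<nu> n" for n
      by (simp add: \<nu>_def)
    have "coprime p q"
      using assms by (simp add: coprime_iff_gcd_eq_1)
    with assms have const: "\<nu> n = \<nu> 0" for n
      by (intro coprime_periods_imp_constant[of \<nu> p q, OF period_p period_q]) simp_all
    \<comment> \<open>The right-hand side is \<open>q\<close> times \<open>\<nu> 0\<close>, and
      \<open>q\<close> is positive.\<close>
    have "(\<Sum>k<q. \<nu> (0 + k)) = (\<Sum>k<q. \<nu> 0)"
      by (intro sum.cong refl const)
    then have "\<nu> 0 = 0"
      using sum_zero[of 0] assms by simp
    then have "\<nu> n = 0" for n
      by (rule trans[OF const])
    moreover have "\<mu> j = \<nu> (j - 1)" if "j \<in> {1..p}" for j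
      using that by (cases j) (simp_all add: \<nu>_def)
    ultimately show "\<forall>j\<in>{1..p}. \<mu> j = 0"
      by simp
  qed
qed

end
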